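(* Let $\theta>0$ be a real number with $\theta^2=\alpha+\sqrt{\beta}$ or $\theta^2=\alpha-\sqrt{\beta}$, where $\alpha,\beta\in\mathbb{Q}$, $\alpha>0$, $\beta>0$, and $\sqrt{\beta}\notin\mathbb{Q}$. Then $\theta$ is good if and only if there exist a positive rational $\lambda$ and positive integers $a,b,c$ with $\gcd(a,b,c)=1$ forming a non-degenerate triangle (i.e. each is strictly less than the sum of the other two), with area $\Delta$ satisfying $4\Delta\sqrt{3}\notin\mathbb{Q}$, such that $$2(\lambda\theta)^2=(a^2+b^2+c^2)+4\Delta\sqrt{3}\quad\text{or}\quad 2(\lambda\theta)^2=(a^2+b^2+c^2)-4\Delta\sqrt{3}.$$
   Context: A positive real number $\theta$ is called "good" if, for the equilateral triangle $T$ with side length $\theta$ in the Euclidean plane, there is a point in the plane of $T$ whose distances to all three vertices of $T$ are rational numbers. For a triangle with side lengths $a,b,c$, the area is $\Delta=\sqrt{s(s-a)(s-b)(s-c)}$ with $s=\tfrac12(a+b+c)$; equivalently $4\Delta\sqrt{3}=\sqrt{3(a+b+c)(-a+b+c)(a-b+c)(a+b-c)}$. *)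

theory Defs
  imports "HOL-Analysis.Analysis"
begin

text \<open>All equilateral triangles of a given side are congruent, so it does not matter which
  one is chosen; the definition asks for some such triangle.\<close>

definition good :: "real \<Rightarrow> bool" where
  "good \<theta> \<longleftrightarrow> \<theta> > 0 \<and>
     (\<exists>A B C :: real^2. dist A B = \<theta> \<and> dist B C = \<theta> \<and> dist C A = \<theta> \<and>
        (\<exists>P :: real^2. dist P A \<in> \<rat> \<and> dist P B \<in> \<rat> \<and> dist P C \<in> \<rat>))"

definition heron_area :: "real \<Rightarrow> real \<Rightarrow> real \<Rightarrow> real" where
  "heron_area a b c =
     (let s = (a + b + c) / 2 in sqrt (s * (s - a) * (s - b) * (s - c)))"

end

theory Submission
  imports Defs
begin

text \<open>Let a point have distances \<open>p\<close>, \<open>q\<close>, \<open>r\<close> to the vertices of an equilateral triangle of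
  side \<open>\<theta>\<close>. Three vectors in the plane have a vanishing Gram determinant; applied to the vectors from
  one vertex to the other two and to the point, this is a quadratic equation for \<open>\<theta>\<^sup>2\<close> whose
  discriminant is, up to squares, three times Heron's product for \<open>p\<close>, \<open>q\<close>, \<open>r\<close>. Conversely the
  equation lets one solve for the point in the basis given by two sides. The equation is homogeneous,
  so rational distances can be scaled to coprime integers. When \<open>\<theta>\<^sup>2\<close> is irrational the discriminant
  is not the square of a rational, hence positive, which forces \<open>p\<close>, \<open>q\<close>, \<open>r\<close> to be the sides of a
  non-degenerate triangle.\<close>

section \<open>Gram determinants\<close>

definition gram_matrix :: "('n \<Rightarrow> 'a::real_inner) \<Rightarrow> real^'n^'n" where
  "gram_matrix f = (\<chi> i j. f i \<bullet> f j)"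

lemma gram_matrix_mult_vec:
  fixes f :: "'n::finite \<Rightarrow> 'a::real_inner"
  shows "(gram_matrix f *v x) $ i = f i \<bullet> (\<Sum>j\<in>UNIV. x $ j *\<^sub>R f j)"
  by (simp add: gram_matrix_def matrix_vector_mult_def inner_sum_right mult.commute)

lemma det_gram_matrix_eq_0:
  fixes f :: "'n::finite \<Rightarrow> 'a::euclidean_space"
  assumes "DIM('a) < CARD('n)"
  shows "det (gram_matrix f) = 0"
proof -
  define L where "L x = (\<Sum>j\<in>UNIV. x $ j *\<^sub>R f j)" for x :: "real^'n"
  have "linear L"
    unfolding L_def by (intro linearI) (simp_all add: scaleR_add_left sum.distrib scaleR_sum_right)
  moreover have "\<not> inj L"
  proof
    assume "inj L"
    then have "dim (range L) = CARD('n)"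
      using \<open>linear L\<close> by (simp add: dim_image_eq inj_on_subset)
    then show False
      using assms dim_subset_UNIV[of "range L"] by simp
  qed
  ultimately obtain x where "x \<noteq> 0" "L x = 0"
    using linear_injective_0 by blast
  then have "gram_matrix f *v x = 0"
    by (simp add: vec_eq_iff gram_matrix_mult_vec L_def)
  then have "\<not> invertible (gram_matrix f)"
    using \<open>x \<noteq> 0\<close> by (auto simp: invertible_left_inverse matrix_left_invertible_ker)
  then show ?thesis
    by (simp add: invertible_det_nz)
qed

section \<open>Heron's product and Pompeiu's relation\<close>

definition heron_product :: "'a::comm_ring \<Rightarrow> 'a \<Rightarrow> 'a \<Rightarrow> 'a" where
  "heron_product a b c = (a + b + c) * (- a + b + c) * (a - b + c) * (a + b - c)"

lemma four_heron_area_sqrt3: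
  "4 * heron_area a b c * sqrt 3 = sqrt (3 * heron_product a b c)"
proof -
  have "heron_area a b c = sqrt (heron_product a b c / 4\<^sup>2)"
    unfolding heron_area_def heron_product_def Let_def
    by (rule arg_cong[where f = sqrt]) (simp add: field_simps power2_eq_square)
  then have "4 * heron_area a b c = sqrt (heron_product a b c)"
    by (simp add: real_sqrt_divide)
  then show ?thesis
    by (simp add: real_sqrt_mult)
qed

lemma heron_product_pos_iff:
  fixes a b c :: "'a::linordered_idom"
  assumes "0 \<le> a" "0 \<le> b" "0 \<le> c"
  shows "0 < heron_product a b c \<longleftrightarrow> a < b + c \<and> b < a + c \<and> c < a + b"
proof
  have less_sum: "z < x + y"
    if "0 \<le> x" "0 \<le> y" "0 \<le> z" and pos: "0 < heron_product x y z" for x y z :: 'a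
  proof (rule ccontr)
    assume "\<not> z < x + y"
    then have "0 \<le> (x + y + z) * (- x + y + z) * (x - y + z)" "x + y - z \<le> 0"
      using that by (auto intro!: mult_nonneg_nonneg)
    then have "heron_product x y z \<le> 0"
      unfolding heron_product_def by (rule mult_nonneg_nonpos)
    then show False using pos by simp
  qed
  have perm: "heron_product b c a = heron_product a b c" "heron_product a c b = heron_product a b c"
    unfolding heron_product_def by algebra+
  assume "0 < heron_product a b c"
  then show "a < b + c \<and> b < a + c \<and> c < a + b"
    using less_sum[of a b c] less_sum[of a c b] less_sum[of b c a] assms by (simp add: perm)
next
  assume "a < b + c \<and> b < a + c \<and> c < a + b"
  then show "0 < heron_product a b c"
    unfolding heron_product_def using assms by (intro mult_pos_pos) linarith+
qed

text \<open>Equivalent to Pompeiu's symmetric equation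
  \<open>3 (\<theta>\<^sup>4 + p\<^sup>4 + q\<^sup>4 + r\<^sup>4) = (\<theta>\<^sup>2 + p\<^sup>2 + q\<^sup>2 + r\<^sup>2)\<^sup>2\<close>, with the square completed in \<open>\<theta>\<^sup>2\<close>.\<close>

definition pompeiu_relation :: "'a::comm_ring_1 \<Rightarrow> 'a \<Rightarrow> 'a \<Rightarrow> 'a \<Rightarrow> bool" where
  "pompeiu_relation \<theta> p q r \<longleftrightarrow> (2 * \<theta>\<^sup>2 - (p\<^sup>2 + q\<^sup>2 + r\<^sup>2))\<^sup>2 = 3 * heron_product p q r"

lemma pompeiu_relation_scale:
  fixes k :: "'a::idom"
  assumes "k \<noteq> 0"
  shows "pompeiu_relation (k * \<theta>) (k * p) (k * q) (k * r) \<longleftrightarrow> pompeiu_relation \<theta> p q r"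
proof -
  have "(2 * (k * \<theta>)\<^sup>2 - ((k * p)\<^sup>2 + (k * q)\<^sup>2 + (k * r)\<^sup>2))\<^sup>2
      = k ^ 4 * (2 * \<theta>\<^sup>2 - (p\<^sup>2 + q\<^sup>2 + r\<^sup>2))\<^sup>2"
    by algebra
  moreover have "3 * heron_product (k * p) (k * q) (k * r) = k ^ 4 * (3 * heron_product p q r)"
    unfolding heron_product_def by algebra
  ultimately show ?thesis
    using assms by (simp only: pompeiu_relation_def mult_cancel_left power_eq_0_iff) simp
qed

lemma pompeiu_relation_iff_heron_area:
  assumes "0 \<le> heron_product p q r"
  shows "pompeiu_relation \<theta> p q r \<longleftrightarrow>
    2 * \<theta>\<^sup>2 = p\<^sup>2 + q\<^sup>2 + r\<^sup>2 + 4 * heron_area p q r * sqrt 3 \<or>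
    2 * \<theta>\<^sup>2 = p\<^sup>2 + q\<^sup>2 + r\<^sup>2 - 4 * heron_area p q r * sqrt 3"
proof -
  have "3 * heron_product p q r = (4 * heron_area p q r * sqrt 3)\<^sup>2"
    unfolding four_heron_area_sqrt3 using assms by simp
  then have "pompeiu_relation \<theta> p q r \<longleftrightarrow>
      (2 * \<theta>\<^sup>2 - (p\<^sup>2 + q\<^sup>2 + r\<^sup>2))\<^sup>2 = (4 * heron_area p q r * sqrt 3)\<^sup>2"
    by (simp only: pompeiu_relation_def)
  then show ?thesis
    unfolding power2_eq_iff by argo
qed

text \<open>Geometrically, \<open>m\<close> and \<open>n\<close> are the inner products of the vector from one vertex to the
  point with the two sides at that vertex.\<close>

lemma pompeiu_relation_iff_inner:
  fixes \<theta> p q r :: "'a::field_char_0"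
  defines "m \<equiv> (\<theta>\<^sup>2 + p\<^sup>2 - q\<^sup>2) / 2" and "n \<equiv> (\<theta>\<^sup>2 + p\<^sup>2 - r\<^sup>2) / 2"
  shows "pompeiu_relation \<theta> p q r \<longleftrightarrow> 4 * (m\<^sup>2 - m * n + n\<^sup>2) = 3 * \<theta>\<^sup>2 * p\<^sup>2"
proof -
  have "(2 * \<theta>\<^sup>2 - (p\<^sup>2 + q\<^sup>2 + r\<^sup>2))\<^sup>2 - 3 * heron_product p q r
      = 4 * (4 * (m\<^sup>2 - m * n + n\<^sup>2) - 3 * \<theta>\<^sup>2 * p\<^sup>2)"
    unfolding m_def n_def heron_product_def by (simp add: power2_eq_square field_simps)
  then show ?thesis
    unfolding pompeiu_relation_def by (metis eq_iff_diff_eq_0 mult_eq_0_iff zero_neq_numeral)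
qed

section \<open>Distances to the vertices of an equilateral triangle\<close>

lemma law_of_cosines:
  fixes A B P :: "'a::real_inner"
  shows "(B - A) \<bullet> (P - A) = ((dist A B)\<^sup>2 + (dist P A)\<^sup>2 - (dist P B)\<^sup>2) / 2"
  using dot_norm_neg[of "B - A" "P - A"] by (simp add: dist_norm norm_minus_commute)

definition equilateral_triangle :: "real \<Rightarrow> 'a::metric_space \<Rightarrow> 'a \<Rightarrow> 'a \<Rightarrow> bool" where
  "equilateral_triangle \<theta> A B C \<longleftrightarrow> dist A B = \<theta> \<and> dist B C = \<theta> \<and> dist C A = \<theta>"

lemma good_altdef:
  "good \<theta> \<longleftrightarrow> \<theta> > 0 \<and> (\<exists>A B C P :: real^2. equilateral_triangle \<theta> A B C \<and>
     dist P A \<in> \<rat> \<and> dist P B \<in> \<rat> \<and> dist P C \<in> \<rat>)"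
  unfolding good_def equilateral_triangle_def by blast

lemma equilateral_triangle_exists:
  assumes "0 \<le> \<theta>"
  obtains A B C :: "real^2" where "equilateral_triangle \<theta> A B C"
proof
  show "equilateral_triangle \<theta> (0 :: real^2) (vector [\<theta>, 0]) (vector [\<theta> / 2, sqrt 3 / 2 * \<theta>])"
    using assms
    by (simp add: equilateral_triangle_def dist_vec_def L2_set_def sum_2 dist_real_def
        power_mult_distrib power_divide real_sqrt_unique)
qed

lemma equilateral_triangle_inner:
  fixes A B C :: "'a::real_inner"
  assumes "equilateral_triangle \<theta> A B C"
  shows "(B - A) \<bullet> (B - A) = \<theta>\<^sup>2" "(C - A) \<bullet> (C - A) = \<theta>\<^sup>2" "(B - A) \<bullet> (C - A) = \<theta>\<^sup>2 / 2"
  using assms by (simp_all add: equilateral_triangle_def law_of_cosines dist_commute)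

lemma pompeiu_relation_dist:
  fixes A B C P :: "'a::euclidean_space"
  assumes "DIM('a) = 2" and "\<theta> \<noteq> 0" and tri: "equilateral_triangle \<theta> A B C"
  shows "pompeiu_relation \<theta> (dist P A) (dist P B) (dist P C)"
proof -
  define m n where "m = (\<theta>\<^sup>2 + (dist P A)\<^sup>2 - (dist P B)\<^sup>2) / 2"
    and "n = (\<theta>\<^sup>2 + (dist P A)\<^sup>2 - (dist P C)\<^sup>2) / 2"
  define u v w where "u = B - A" and "v = C - A" and "w = P - A"
  have sides: "u \<bullet> u = \<theta>\<^sup>2" "v \<bullet> v = \<theta>\<^sup>2" "u \<bullet> v = \<theta>\<^sup>2 / 2"
    using equilateral_triangle_inner[OF tri] by (simp_all add: u_def v_def)
  have point: "u \<bullet> w = m" "v \<bullet> w = n" "w \<bullet> w = (dist P A)\<^sup>2"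
    using tri by (simp_all add: law_of_cosines equilateral_triangle_def dist_commute
        m_def n_def u_def v_def w_def)
  define f :: "3 \<Rightarrow> 'a" where "f = ($) (vector [u, v, w])"
  have "0 = det (gram_matrix f)"
    using det_gram_matrix_eq_0[of f] assms(1) by simp
  also have "\<dots> = \<theta>\<^sup>2 * (3 * \<theta>\<^sup>2 * (dist P A)\<^sup>2 - 4 * (m\<^sup>2 - m * n + n\<^sup>2)) / 4"
    using inner_commute[of v u] inner_commute[of w u] inner_commute[of w v]
    by (simp add: det_3 gram_matrix_def f_def sides point power2_eq_square field_simps)
  finally show ?thesis
    using \<open>\<theta> \<noteq> 0\<close> unfolding pompeiu_relation_iff_inner m_def n_def by simp
qed

lemma pompeiu_relation_obtains_point:
  fixes A B C :: "'a::real_inner"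
  assumes "\<theta> \<noteq> 0" and tri: "equilateral_triangle \<theta> A B C"
    and "0 \<le> p" "0 \<le> q" "0 \<le> r" and rel: "pompeiu_relation \<theta> p q r"
  obtains P where "dist P A = p" "dist P B = q" "dist P C = r"
proof -
  define m n where "m = (\<theta>\<^sup>2 + p\<^sup>2 - q\<^sup>2) / 2" and "n = (\<theta>\<^sup>2 + p\<^sup>2 - r\<^sup>2) / 2"
  define s t where "s = (4 * m - 2 * n) / (3 * \<theta>\<^sup>2)" and "t = (4 * n - 2 * m) / (3 * \<theta>\<^sup>2)"
  define u v w where "u = B - A" and "v = C - A" and "w = s *\<^sub>R u + t *\<^sub>R v"
  have sides: "u \<bullet> u = \<theta>\<^sup>2" "v \<bullet> v = \<theta>\<^sup>2" "u \<bullet> v = \<theta>\<^sup>2 / 2" "v \<bullet> u = \<theta>\<^sup>2 / 2"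
    using equilateral_triangle_inner[OF tri] by (simp_all add: u_def v_def inner_commute)
  have inner: "u \<bullet> w = m" "v \<bullet> w = n"
    using \<open>\<theta> \<noteq> 0\<close> by (simp_all add: w_def inner_add_right sides s_def t_def field_simps)
  have "w \<bullet> w = s * m + t * n"
    by (subst w_def) (simp only: inner_add_left inner_scaleR_left inner)
  also have "\<dots> = 4 * (m\<^sup>2 - m * n + n\<^sup>2) / (3 * \<theta>\<^sup>2)"
    by (simp add: s_def t_def power2_eq_square add_divide_distrib[symmetric] algebra_simps)
  also have "\<dots> = p\<^sup>2"
    using rel \<open>\<theta> \<noteq> 0\<close> unfolding pompeiu_relation_iff_inner m_def[symmetric] n_def[symmetric] by simp
  finally have dist_A: "(dist (A + w) A)\<^sup>2 = p\<^sup>2"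
    by (simp add: dist_norm power2_norm_eq_inner)
  moreover have "(dist (A + w) B)\<^sup>2 = q\<^sup>2" "(dist (A + w) C)\<^sup>2 = r\<^sup>2"
    using inner dist_A tri law_of_cosines[of B A "A + w"] law_of_cosines[of C A "A + w"]
    by (simp_all add: equilateral_triangle_def dist_commute m_def n_def u_def v_def field_simps)
  ultimately show thesis
    using that assms(3-5) by simp
qed

lemma good_iff_pompeiu_relation:
  assumes "\<theta> > 0"
  shows "good \<theta> \<longleftrightarrow>
    (\<exists>p\<in>\<rat>. \<exists>q\<in>\<rat>. \<exists>r\<in>\<rat>. 0 \<le> p \<and> 0 \<le> q \<and> 0 \<le> r \<and> pompeiu_relation \<theta> p q r)"
  (is "_ \<longleftrightarrow> ?R")
proof
  assume "good \<theta>"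
  then obtain A B C P :: "real^2" where "equilateral_triangle \<theta> A B C"
    and rat: "dist P A \<in> \<rat>" "dist P B \<in> \<rat>" "dist P C \<in> \<rat>"
    unfolding good_altdef by blast
  then have "pompeiu_relation \<theta> (dist P A) (dist P B) (dist P C)"
    using \<open>\<theta> > 0\<close> by (intro pompeiu_relation_dist) simp_all
  then show ?R
    using rat zero_le_dist by blast
next
  assume ?R
  then obtain p q r where rat: "p \<in> \<rat>" "q \<in> \<rat>" "r \<in> \<rat>"
    and rel: "0 \<le> p" "0 \<le> q" "0 \<le> r" "pompeiu_relation \<theta> p q r"
    by blast
  obtain A B C :: "real^2" where tri: "equilateral_triangle \<theta> A B C"
    using equilateral_triangle_exists \<open>\<theta> > 0\<close> by (metis less_imp_le)
  obtain P where "dist P A = p" "dist P B = q" "dist P C = r"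
    using pompeiu_relation_obtains_point[OF _ tri rel] \<open>\<theta> > 0\<close> by auto
  then show "good \<theta>"
    using \<open>\<theta> > 0\<close> tri rat unfolding good_altdef by blast
qed

section \<open>Primitive integer multiples\<close>

lemma Rats_common_denominator:
  fixes S :: "'a::field_char_0 set"
  assumes "finite S" "S \<subseteq> \<rat>"
  obtains n :: nat where "n > 0" "\<And>x. x \<in> S \<Longrightarrow> of_nat n * x \<in> \<int>"
  using assms
proof (induction S arbitrary: thesis rule: finite_induct)
  case empty
  show ?case by (rule empty(1)[of 1]) simp_all
next
  case (insert x S)
  obtain n :: nat where n: "n > 0" "\<And>y. y \<in> S \<Longrightarrow> of_nat n * y \<in> \<int>"
    using insert.IH insert.prems(2) by blast
  obtain a b :: int where x: "b > 0" "x = of_int a / of_int b"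
    using insert.prems(2) by (auto elim: Rats_cases')
  have "of_nat (nat b * n) * y \<in> \<int>" if "y \<in> insert x S" for y
  proof (cases "y = x")
    case True
    then have "of_nat (nat b * n) * y = of_int (int n * a)"
      using x by (simp add: field_simps)
    then show ?thesis by (simp only: Ints_of_int)
  next
    case False
    then have "of_int b * (of_nat n * y) \<in> \<int>"
      using that n(2) by simp
    then show ?thesis
      using x(1) by (simp add: mult.assoc)
  qed
  then show ?case
    using insert.prems(1)[of "nat b * n"] n(1) x(1) by simp
qed

lemma Gcd_image_div_Gcd:
  fixes f :: "'a \<Rightarrow> 'b::semiring_Gcd"
  assumes "\<not> f ` S \<subseteq> {0}"
  shows "Gcd ((\<lambda>x. f x div Gcd (f ` S)) ` S) = 1"
proof -
  define g D where "g = Gcd (f ` S)" and "D = Gcd ((\<lambda>x. f x div g) ` S)"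
  have "g * (f x div g) = f x" if "x \<in> S" for x
    unfolding g_def using that by (intro dvd_mult_div_cancel Gcd_dvd imageI)
  then have "(*) g ` (\<lambda>x. f x div g) ` S = f ` S"
    by (simp add: image_image)
  then have "g = normalize (g * D)"
    unfolding D_def by (metis Gcd_mult g_def)
  then have "g * D dvd g * 1"
    by (metis dvd_normalize_iff dvd_refl mult_1_right)
  moreover have "g \<noteq> 0"
    using assms by (simp add: g_def)
  ultimately have "D dvd 1"
    by (metis dvd_times_left_cancel_iff)
  then have "normalize D = 1"
    by (rule is_unit_normalize)
  then show ?thesis
    by (simp add: D_def g_def)
qed

lemma Rats_primitive_multiple:
  fixes S :: "'a::linordered_field set"
  assumes "finite S" "S \<subseteq> \<rat>" and nonneg: "\<And>x. x \<in> S \<Longrightarrow> 0 \<le> x" and "\<not> S \<subseteq> {0}"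
  obtains l :: 'a and a :: "'a \<Rightarrow> nat"
  where "l \<in> \<rat>" "l > 0" "Gcd (a ` S) = 1" "\<And>x. x \<in> S \<Longrightarrow> of_nat (a x) = l * x"
proof -
  obtain n :: nat where "n > 0" and Ints: "\<And>x. x \<in> S \<Longrightarrow> of_nat n * x \<in> \<int>"
    using Rats_common_denominator assms(1,2) by blast
  have "\<exists>k. of_nat k = of_nat n * x" if "x \<in> S" for x
  proof -
    have "of_nat n * x \<in> \<nat>"
      using Ints[OF that] nonneg[OF that] by (simp add: Nats_altdef2)
    then show ?thesis by (metis Nats_cases)
  qed
  then obtain b :: "'a \<Rightarrow> nat" where b: "\<And>x. x \<in> S \<Longrightarrow> of_nat (b x) = of_nat n * x"
    by metis
  define g where "g = Gcd (b ` S)"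
  have "\<not> b ` S \<subseteq> {0}"
    using \<open>\<not> S \<subseteq> {0}\<close> \<open>n > 0\<close> b by force
  then have "g > 0"
    unfolding g_def by (metis Gcd_0_iff gr0I)
  have dvd: "g * (b x div g) = b x" if "x \<in> S" for x
    using that by (simp add: g_def)
  show thesis
  proof (rule that[of "of_nat n / of_nat g" "\<lambda>x. b x div g"])
    show "of_nat n / of_nat g \<in> (\<rat> :: 'a set)" "(0 :: 'a) < of_nat n / of_nat g"
      using \<open>n > 0\<close> \<open>g > 0\<close> by simp_all
    show "Gcd ((\<lambda>x. b x div g) ` S) = 1"
      using Gcd_image_div_Gcd[OF \<open>\<not> b ` S \<subseteq> {0}\<close>] by (simp only: g_def)
    show "of_nat (b x div g) = of_nat n / of_nat g * x" if "x \<in> S" for x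
    proof -
      have "of_nat g * of_nat (b x div g) = of_nat n * x"
        by (simp only: dvd b that flip: of_nat_mult)
      then show ?thesis
        using \<open>g > 0\<close> by (simp add: field_simps)
    qed
  qed
qed

lemma good_iff_primitive_pompeiu_relation:
  assumes "\<theta> > 0"
  shows "good \<theta> \<longleftrightarrow> (\<exists>(l::real) (a::nat) (b::nat) (c::nat). l \<in> \<rat> \<and> l > 0 \<and>
    gcd a (gcd b c) = 1 \<and> pompeiu_relation (l * \<theta>) (real a) (real b) (real c))"
  (is "_ \<longleftrightarrow> ?R")
proof
  assume "good \<theta>"
  then obtain p q r where rat: "p \<in> \<rat>" "q \<in> \<rat>" "r \<in> \<rat>"
    and nonneg: "0 \<le> p" "0 \<le> q" "0 \<le> r" and rel: "pompeiu_relation \<theta> p q r"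
    unfolding good_iff_pompeiu_relation[OF \<open>\<theta> > 0\<close>] by blast
  have "\<not> {p, q, r} \<subseteq> {0}"
    using rel \<open>\<theta> > 0\<close> by (auto simp: pompeiu_relation_def heron_product_def)
  then obtain l :: real and a :: "real \<Rightarrow> nat"
    where l: "l \<in> \<rat>" "l > 0" and prim: "Gcd (a ` {p, q, r}) = 1"
      and scale: "\<And>x. x \<in> {p, q, r} \<Longrightarrow> real (a x) = l * x"
    using Rats_primitive_multiple[of "{p, q, r}"] rat nonneg by auto
  have "pompeiu_relation (l * \<theta>) (a p) (a q) (a r)"
    using rel l by (simp add: scale pompeiu_relation_scale)
  moreover have "gcd (a p) (gcd (a q) (a r)) = 1"
    using prim by simp
  ultimately show ?R
    using l by (intro exI conjI)
next
  assume ?R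
  then obtain l and a b c :: nat where l: "l \<in> \<rat>" "l > 0"
    and "pompeiu_relation (l * \<theta>) (real a) (real b) (real c)"
    by blast
  then have "pompeiu_relation \<theta> (a / l) (b / l) (c / l)"
    using pompeiu_relation_scale[of l \<theta> "a / l" "b / l" "c / l"] by simp
  moreover have "a / l \<in> \<rat>" "b / l \<in> \<rat>" "c / l \<in> \<rat>" "0 \<le> a / l" "0 \<le> b / l" "0 \<le> c / l"
    using l by simp_all
  ultimately show "good \<theta>"
    unfolding good_iff_pompeiu_relation[OF \<open>\<theta> > 0\<close>] by blast
qed

section \<open>Triangles with irrational squared side\<close>

lemma pompeiu_relation_irrational:
  assumes rat: "p \<in> \<rat>" "q \<in> \<rat>" "r \<in> \<rat>" and irrat: "\<theta>\<^sup>2 \<notin> \<rat>"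
    and rel: "pompeiu_relation \<theta> p q r"
  shows "0 < heron_product p q r" and "4 * heron_area p q r * sqrt 3 \<notin> \<rat>"
proof -
  have diff_irrat: "2 * \<theta>\<^sup>2 - (p\<^sup>2 + q\<^sup>2 + r\<^sup>2) \<notin> \<rat>" (is "?d \<notin> \<rat>")
  proof
    assume "?d \<in> \<rat>"
    then have "(?d + (p\<^sup>2 + q\<^sup>2 + r\<^sup>2)) / 2 \<in> \<rat>"
      using rat by (intro Rats_divide Rats_add) simp_all
    then show False using irrat by simp
  qed
  then have "0 < ?d\<^sup>2"
    by (metis Rats_0 zero_less_power2)
  then show pos: "0 < heron_product p q r"
    using rel unfolding pompeiu_relation_def by linarith
  have "?d = 4 * heron_area p q r * sqrt 3 \<or> ?d = - (4 * heron_area p q r * sqrt 3)"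
    using rel pos by (auto simp: pompeiu_relation_iff_heron_area)
  then show "4 * heron_area p q r * sqrt 3 \<notin> \<rat>"
    using diff_irrat by (metis Rats_minus_iff)
qed

lemma pompeiu_relation_irrational_iff:
  assumes rat: "p \<in> \<rat>" "q \<in> \<rat>" "r \<in> \<rat>" and nonneg: "0 \<le> p" "0 \<le> q" "0 \<le> r"
    and irrat: "\<theta>\<^sup>2 \<notin> \<rat>"
  shows "pompeiu_relation \<theta> p q r \<longleftrightarrow>
    p < q + r \<and> q < p + r \<and> r < p + q \<and>
    4 * heron_area p q r * sqrt 3 \<notin> \<rat> \<and>
    (2 * \<theta>\<^sup>2 = p\<^sup>2 + q\<^sup>2 + r\<^sup>2 + 4 * heron_area p q r * sqrt 3 \<or>
     2 * \<theta>\<^sup>2 = p\<^sup>2 + q\<^sup>2 + r\<^sup>2 - 4 * heron_area p q r * sqrt 3)"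
proof (cases "0 < heron_product p q r")
  case True
  then show ?thesis
    using pompeiu_relation_irrational(2)[OF rat irrat] heron_product_pos_iff[OF nonneg]
      pompeiu_relation_iff_heron_area[of p q r \<theta>] by auto
next
  case False
  then show ?thesis
    using pompeiu_relation_irrational(1)[OF rat irrat] heron_product_pos_iff[OF nonneg] by blast
qed

theorem theorem2:
  fixes \<theta> \<alpha> \<beta> :: real
  assumes "\<theta> > 0"
    and "\<alpha> \<in> \<rat>" and "\<beta> \<in> \<rat>" and "\<alpha> > 0" and "\<beta> > 0" and "sqrt \<beta> \<notin> \<rat>"
    and "\<theta>\<^sup>2 = \<alpha> + sqrt \<beta> \<or> \<theta>\<^sup>2 = \<alpha> - sqrt \<beta>"
  shows "good \<theta> \<longleftrightarrow>
    (\<exists>(l::real) (a::nat) (b::nat) (c::nat).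
       l \<in> \<rat> \<and> l > 0 \<and>
       a > 0 \<and> b > 0 \<and> c > 0 \<and> gcd a (gcd b c) = 1 \<and>
       a < b + c \<and> b < a + c \<and> c < a + b \<and>
       4 * heron_area (real a) (real b) (real c) * sqrt 3 \<notin> \<rat> \<and>
       (2 * (l * \<theta>)\<^sup>2 =
          (real a)\<^sup>2 + (real b)\<^sup>2 + (real c)\<^sup>2 + 4 * heron_area (real a) (real b) (real c) * sqrt 3 \<or>
        2 * (l * \<theta>)\<^sup>2 =
          (real a)\<^sup>2 + (real b)\<^sup>2 + (real c)\<^sup>2 - 4 * heron_area (real a) (real b) (real c) * sqrt 3))"
proof -
  have irrat: "(l * \<theta>)\<^sup>2 \<notin> \<rat>" if "l \<in> \<rat>" "l > 0" for l
  proof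
    assume "(l * \<theta>)\<^sup>2 \<in> \<rat>"
    then have "(l * \<theta>)\<^sup>2 / l\<^sup>2 \<in> \<rat>"
      using that by (intro Rats_divide) simp_all
    then have "\<theta>\<^sup>2 - \<alpha> \<in> \<rat>" "\<alpha> - \<theta>\<^sup>2 \<in> \<rat>"
      using that \<open>\<alpha> \<in> \<rat>\<close> by (simp_all add: power_mult_distrib)
    then show False
      using assms(6,7) by auto
  qed
  note relation_iff = pompeiu_relation_irrational_iff[OF Rats_of_nat Rats_of_nat Rats_of_nat
      of_nat_0_le_iff of_nat_0_le_iff of_nat_0_le_iff irrat,
      folded of_nat_add, unfolded of_nat_less_iff]
  have sides_pos: "0 < a \<and> 0 < b \<and> 0 < c" if "a < b + c" "b < a + c" "c < a + b" for a b c :: nat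
    using that by linarith
  show ?thesis
    unfolding good_iff_primitive_pompeiu_relation[OF \<open>\<theta> > 0\<close>]
    by (intro iff_exI) (use relation_iff sides_pos in blast)
qed

end
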